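(* Let $F\in L^2_{\rm loc}(\mathbb{R}^n_{+})$ and let $\varphi:[0,\infty)\to[0,\infty)$ be a non-decreasing function. Let $Q_0\subset\mathbb{R}^{n-1}$ be an arbitrary half-open cube, or $Q_0=\mathbb{R}^{n-1}$. Assume that there are numbers $\alpha\in(0,1)$ and $N\in(0,\infty)$ such that $$\bigg|\bigg\{x'\in Q:\,\frac{1}{\varphi(\ell(Q))}\bigg(\int_0^{\ell(Q)}\int_{|x'-y'|<\kappa s}|F(y',s)|^2\,dy'\frac{ds}{s^n}\bigg)^{1/2}>N\bigg\}\bigg|\leq\alpha|Q|$$ for every cube $Q\in\mathbb{D}_{Q_0}$ and $\kappa:=1+2\sqrt{n-1}$. Then, for every $t>0$, $$\sup_{Q\in\mathbb{D}_{Q_0}}\frac{1}{|Q|}\bigg|\bigg\{x'\in Q:\,\frac{1}{\varphi(\ell(Q))}\bigg(\int_0^{\ell(Q)}\int_{|x'-y'|<\kappa s}|F(y',s)|^2\,dy'\frac{ds}{s^n}\bigg)^{1/2}>t\bigg\}\bigg|\leq\frac{1}{\alpha}\,e^{-\frac{\log(\alpha^{-1})}{N}\,t}.$$ Hence, for each $q\in(0,\infty)$ there exists a finite constant $C=C(\alpha,q)\geq1$ such that $$\sup_{Q\in\mathbb{D}_{Q_0}}\frac{1}{\varphi(\ell(Q))}\bigg(\fint_Q\bigg(\int_{0}^{\ell(Q)}\int_{|x'-y'|<s}|F(y',s)|^2\,dy'\frac{ds}{s^n}\bigg)^{q/2}\,dx'\bigg)^{1/q}\leq CN.$$ Moreover,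 there exists some finite $C=C(\alpha)\geq1$ such that $$\sup_{Q\in\mathbb{D}_{Q_0}}\frac{1}{\varphi(\ell(Q))}\bigg\|\bigg(\int_{0}^{\ell(Q)}\int_{|\,\cdot\,-y'|<s}|F(y',s)|^2\,dy'\frac{ds}{s^n}\bigg)^{1/2}\bigg\|_{\exp L,Q}\leq CN.$$
   Context: Here $n\ge2$ is an integer and $\mathbb{R}^n_+=\{(y',s):y'\in\mathbb{R}^{n-1},\,s>0\}$. Cubes in $\mathbb{R}^{n-1}$ are half-open with sides parallel to the axes: $Q=[a_1,a_1+\ell(Q))\times\dots\times[a_{n-1},a_{n-1}+\ell(Q))$ with $a_i\in\mathbb{R}$, $\ell(Q)>0$. For a cube $Q_0$, $\mathbb{D}_{Q_0}$ is the collection of all half-open dyadic subcubes of $Q_0$ (obtained by repeated dyadic subdivision, including $Q_0$ itself); for $Q_0=\mathbb{R}^{n-1}$, $\mathbb{D}_{Q_0}$ is the classical dyadic grid generated by $[0,1)^{n-1}$ (or any other dyadic grid). $|\cdot|$ applied to sets is Lebesgue measure in $\mathbb{R}^{n-1}$, $\fint_Q h=\frac1{|Q|}\int_Q h$, and $\|f\|_{\exp L,Q}:=\inf\{t>0:\fint_Q(e^{|f(x')|/t}-1)\,dx'\le1\}$.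
   Formalization: In the first conclusion (the exponential tail estimate) the cone |x'-y'|<κs is replaced by |x'-y'|<s; with κ there the estimate is false, e.g. for n=2, Q_0=[0,1) and F a large multiple of the indicator of [3,3.05]×[0.95,0.99]. *)

theory Defs
  imports "HOL-Analysis.Analysis"
begin

text \<open>
  The boundary space \<open>\<real>\<^sup>n\<^sup>-\<^sup>1\<close> is \<^typ>\<open>real ^ 'd\<close>, so that \<open>n = CARD('d) + 1\<close> and \<open>n \<ge> 2\<close> holds
  automatically; points of the upper half-space are pairs \<open>(y, s)\<close>.
\<close>

definition upper_half_space :: "((real ^ 'd) \<times> real) set" where
  "upper_half_space = {(y, s). 0 < s}"

definition L2_loc :: "'a::euclidean_space set \<Rightarrow> ('a \<Rightarrow> complex) \<Rightarrow> bool" where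
  "L2_loc S F \<longleftrightarrow>
     F \<in> borel_measurable (lebesgue_on S) \<and>
     (\<forall>K. compact K \<and> K \<subseteq> S \<longrightarrow> (\<lambda>z. (cmod (F z))\<^sup>2) absolutely_integrable_on K)"

text \<open>
  A half-open cube \<open>Q\<close> is encoded by the pair of its lower corner and its side length \<open>\<ell>(Q)\<close>;
  \<open>cube_set\<close> gives the set of its points.
\<close>

type_synonym 'd cube = "(real ^ 'd) \<times> real"

fun cube_set :: "'d::finite cube \<Rightarrow> (real ^ 'd) set" where
  "cube_set (a, l) = {x. \<forall>i. a $ i \<le> x $ i \<and> x $ i < a $ i + l}"

abbreviation side :: "'d::finite cube \<Rightarrow> real" where
  "side Q \<equiv> snd Q"

fun dyadic_children :: "'d::finite cube \<Rightarrow> 'd cube set" where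
  "dyadic_children (a, l) =
     {(a + (l / 2) *\<^sub>R e, l / 2) | e. \<forall>i. e $ i = 0 \<or> e $ i = 1}"

inductive_set dyadic_subcubes :: "'d::finite cube \<Rightarrow> 'd cube set" for Q0 :: "'d cube" where
  root: "Q0 \<in> dyadic_subcubes Q0"
| child: "Q \<in> dyadic_subcubes Q0 \<Longrightarrow> R \<in> dyadic_children Q \<Longrightarrow> R \<in> dyadic_subcubes Q0"

text \<open>
  Dyadic grids of the whole space: all side lengths are \<open>c 2\<^sup>k\<close> for a fixed \<open>c > 0\<close>, the cubes of
  each generation \<open>k \<in> \<int>\<close> partition the space, and each generation is refined by dyadic subdivision.
\<close>

definition dyadic_grid :: "'d::finite cube set \<Rightarrow> bool" where
  "dyadic_grid D \<longleftrightarrow>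
     (\<exists>c>0. (\<forall>Q\<in>D. \<exists>k::int. side Q = c * 2 powi k) \<and>
            (\<forall>k::int. \<forall>x. \<exists>!Q. Q \<in> D \<and> side Q = c * 2 powi k \<and> x \<in> cube_set Q)) \<and>
     (\<forall>Q\<in>D. dyadic_children Q \<subseteq> D)"

definition classical_dyadic_grid :: "'d::finite cube set" where
  "classical_dyadic_grid =
     {(2 powi k *\<^sub>R m, 2 powi k) | (k::int) m. \<forall>i. m $ i \<in> \<int>}"

lemma dyadic_grid_classical: "dyadic_grid (classical_dyadic_grid :: 'd::finite cube set)"
proof -
  have part: "\<exists>!Q. Q \<in> (classical_dyadic_grid :: 'd cube set) \<and> side Q = 1 * 2 powi k \<and> x \<in> cube_set Q"
    for k :: int and x :: "real ^ 'd"
  proof -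
    define p :: real where "p = 2 powi k"
    have p: "p > 0" by (simp add: p_def)
    define m :: "real ^ 'd" where "m = (\<chi> i. of_int \<lfloor>x $ i / p\<rfloor>)"
    have iff: "p * z \<le> x $ i \<and> x $ i < p * z + p \<longleftrightarrow> z = m $ i" if z: "z \<in> \<int>" for z i
    proof -
      obtain j where j: "z = of_int j" using z by (auto elim: Ints_cases)
      have "p * z \<le> x $ i \<and> x $ i < p * z + p \<longleftrightarrow> z \<le> x $ i / p \<and> x $ i / p < z + 1"
        using p by (simp add: field_simps)
      also have "\<dots> \<longleftrightarrow> \<lfloor>x $ i / p\<rfloor> = j" by (auto simp: j floor_eq_iff)
      also have "\<dots> \<longleftrightarrow> z = m $ i" by (auto simp: j m_def)
      finally show ?thesis .
    qed
    have mZ: "m $ i \<in> \<int>" for i by (simp add: m_def)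
    show ?thesis
    proof (rule ex1I[of _ "(p *\<^sub>R m, p)"], intro conjI)
      show "(p *\<^sub>R m, p) \<in> classical_dyadic_grid"
        using mZ by (auto simp: classical_dyadic_grid_def p_def)
      show "side (p *\<^sub>R m, p) = 1 * 2 powi k" by (simp add: p_def)
      show "x \<in> cube_set (p *\<^sub>R m, p)" using iff[OF mZ] by simp
    next
      fix Q :: "'d cube"
      assume Q: "Q \<in> classical_dyadic_grid \<and> side Q = 1 * 2 powi k \<and> x \<in> cube_set Q"
      then obtain m' where m': "Q = (p *\<^sub>R m', p)" "\<And>i. m' $ i \<in> \<int>"
        by (auto simp: classical_dyadic_grid_def p_def)
      have "x \<in> cube_set Q" using Q by blast
      then have "m' $ i = m $ i" for i
        using iff[OF m'(2)[of i], of i] by (simp add: m'(1))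
      then show "Q = (p *\<^sub>R m, p)" by (simp add: m'(1) vec_eq_iff)
    qed
  qed
  have child: "dyadic_children Q \<subseteq> (classical_dyadic_grid :: 'd cube set)"
    if "Q \<in> classical_dyadic_grid" for Q :: "'d cube"
  proof
    fix R assume R: "R \<in> dyadic_children Q"
    obtain k :: int and m where Q: "Q = (2 powi k *\<^sub>R m, 2 powi k)" and m: "\<And>i. m $ i \<in> \<int>"
      using \<open>Q \<in> classical_dyadic_grid\<close> by (auto simp: classical_dyadic_grid_def)
    obtain e where e: "R = (2 powi k *\<^sub>R m + (2 powi k / 2) *\<^sub>R e, 2 powi k / 2)"
      "\<And>i. e $ i = 0 \<or> e $ i = 1"
      using R by (auto simp: Q)
    have k: "(2::real) powi k = 2 * 2 powi (k - 1)"
      by (simp add: power_int_diff)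
    have "R = (2 powi (k - 1) *\<^sub>R (2 *\<^sub>R m + e), 2 powi (k - 1))"
      unfolding e(1) k by (simp add: scaleR_add_right)
    moreover have "(2 *\<^sub>R m + e) $ i \<in> \<int>" for i
      using m[of i] e(2)[of i] by auto
    ultimately show "R \<in> classical_dyadic_grid"
      unfolding classical_dyadic_grid_def by blast
  qed
  have "\<forall>Q\<in>(classical_dyadic_grid :: 'd cube set). \<exists>k::int. side Q = 1 * 2 powi k"
    by (auto simp: classical_dyadic_grid_def)
  with part child show ?thesis
    unfolding dyadic_grid_def by (intro conjI exI[of _ "1::real"] allI ballI) auto
qed

text \<open>
  All integrals are taken in \<open>[0, \<infinity>]\<close>, since square functions of an \<open>L\<^sup>2\<^sub>l\<^sub>o\<^sub>c\<close> function may be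
  infinite.  For these we need the real powers (used for exponents \<open>p > 0\<close> only) and \<open>e\<^sup>u - 1\<close>,
  both with value \<open>\<infinity>\<close> at \<open>\<infinity>\<close>.  Divisions in \<^typ>\<open>ennreal\<close> follow \<open>0 / 0 = 0\<close> and
  \<open>u / 0 = \<infinity>\<close> for \<open>u > 0\<close>.
\<close>

definition ennreal_powr :: "ennreal \<Rightarrow> real \<Rightarrow> ennreal" where
  "ennreal_powr u p = (if u = top then top else ennreal (enn2real u powr p))"

definition ennreal_expm1 :: "ennreal \<Rightarrow> ennreal" where
  "ennreal_expm1 u = (if u = top then top else ennreal (exp (enn2real u) - 1))"

definition average :: "'d::finite cube \<Rightarrow> (real ^ 'd \<Rightarrow> ennreal) \<Rightarrow> ennreal" where
  "average Q h = (\<integral>\<^sup>+x\<in>cube_set Q. h x \<partial>lebesgue) / emeasure lebesgue (cube_set Q)"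

definition expL_norm :: "'d::finite cube \<Rightarrow> (real ^ 'd \<Rightarrow> ennreal) \<Rightarrow> ennreal" where
  "expL_norm Q f = Inf {ennreal t | t. 0 < t \<and> average Q (\<lambda>x. ennreal_expm1 (f x / ennreal t)) \<le> 1}"

text \<open>
  \<open>cone_integral \<kappa> F r x\<close> is the integral of \<open>|F(y, s)|\<^sup>2 dy ds / s\<^sup>n\<close> over the truncated cone
  \<open>|x - y| < \<kappa> s\<close>, \<open>0 < s < r\<close>.  Pitfall: from a level set bound at aperture
  \<open>\<kappa> = 1 + 2 sqrt (n - 1)\<close>, exponential decay follows only at aperture \<open>1\<close>.  At aperture \<open>\<kappa>\<close>
  itself it fails: for \<open>n = 2\<close>, \<open>Q0 = [0,1)\<close>, a large multiple of the indicator function of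
  \<open>[3, 3.05] \<times> [0.95, 0.99]\<close> is invisible from \<open>[0, 0.03)\<close> and from all proper dyadic subcubes of
  \<open>Q0\<close>, but its square function is arbitrarily large on \<open>[0.3, 1)\<close>.
\<close>

definition cone_integral ::
  "real \<Rightarrow> ((real ^ 'd) \<times> real \<Rightarrow> complex) \<Rightarrow> real \<Rightarrow> real ^ 'd::finite \<Rightarrow> ennreal" where
  "cone_integral \<kappa> F r x =
     (\<integral>\<^sup>+s\<in>{0<..<r}. (\<integral>\<^sup>+y\<in>{y. norm (x - y) < \<kappa> * s}. ennreal ((cmod (F (y, s)))\<^sup>2) \<partial>lebesgue)
        / ennreal (s ^ (CARD('d) + 1)) \<partial>lebesgue)"

end

theory Submission
  imports Defs "HOL-Real_Asymp.Real_Asymp"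
begin

text \<open>
  By Tonelli, \<open>cone_integral \<kappa> F r x\<close> is the measure of a truncated cone for the measure with density
  \<open>|F|\<^sup>2 / s\<^sup>n\<close>; it is lower semicontinuous in \<open>x\<close>. For \<open>Q \<in> D\<close> let \<open>\<Omega>\<close> be the open set where
  the square function of \<open>Q\<close> at aperture \<open>\<kappa> = 1 + 2 sqrt (n - 1)\<close> exceeds \<open>N \<phi>(\<ell>(Q))\<close>. It does not
  contain \<open>Q\<close>, and \<open>\<Omega> \<inter> Q\<close> is a union of dyadic cubes \<open>C\<close> whose parents contain a point
  outside \<open>\<Omega>\<close>. The part above \<open>C\<close> of the cone at \<open>x \<in> C\<close> lies in the wide cone at that point.
  Hence if the narrow square function of \<open>Q\<close> exceeds \<open>(t + N) \<phi>(\<ell>(Q))\<close> at \<open>x\<close>, then that of \<open>C\<close>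
  exceeds \<open>t \<phi>(\<ell>(C))\<close>. So \<open>\<Xi>(t + N) \<le> \<alpha> \<Xi>(t)\<close> for the normalised distribution function \<open>\<Xi>\<close>, and
  iteration gives exponential decay. The norm bounds follow by summing over the level sets
  at \<open>k N\<close>, whose relative measure is at most \<open>\<alpha>\<^sup>k\<close>.
\<close>

section \<open>Truncated cones, and the square function as the measure of a cone\<close>

definition truncated_cone :: "real \<Rightarrow> real \<Rightarrow> (real ^ 'd::finite) \<Rightarrow> ((real ^ 'd) \<times> real) set" where
  "truncated_cone \<kappa> r x = {(y, s). 0 < s \<and> s < r \<and> norm (x - y) < \<kappa> * s}"

lemma open_truncated_cone: "open (truncated_cone \<kappa> r x)"
  unfolding truncated_cone_def case_prod_unfold
  by (intro open_Collect_conj open_Collect_less continuous_intros)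

lemma truncated_cone_borel [measurable]: "truncated_cone \<kappa> r x \<in> sets borel"
  by (rule borel_open[OF open_truncated_cone])

lemma truncated_cone_mono:
  assumes "\<kappa> \<le> \<kappa>'" "r \<le> r'"
  shows "truncated_cone \<kappa> r x \<subseteq> truncated_cone \<kappa>' r' x"
proof -
  have "norm (x - y) < \<kappa>' * s" if "0 < s" "norm (x - y) < \<kappa> * s" for y s
    using that mult_right_mono[of \<kappa> \<kappa>' s] assms by linarith
  then show ?thesis using assms by (auto simp: truncated_cone_def)
qed

text \<open>Fatou's lemma for sets: the cones are open, so if \<open>X n\<close> tends to
  \<open>l\<close>, each point of the cone at \<open>l\<close> lies in the cones at
  \<open>X m\<close> for all large \<open>m\<close>. Only continuity from below enters, so cones of
  infinite measure are harmless. Openness gives both measurability of the level sets and the open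
  set that the stopping argument needs.\<close>

lemma open_emeasure_truncated_cone_gt:
  assumes "sets M = sets borel"
  shows "open {x. c < emeasure M (truncated_cone \<kappa> r x)}"
proof -
  let ?T = "truncated_cone \<kappa> r"
  have "closed {x. emeasure M (?T x) \<le> c}"
    unfolding closed_sequential_limits
  proof safe
    fix X l assume X: "\<forall>n. X n \<in> {x. emeasure M (?T x) \<le> c}" and lim: "X \<longlonglongrightarrow> l"
    let ?A = "\<lambda>n. \<Inter>m\<in>{n..}. ?T (X m)"
    have A: "range ?A \<subseteq> sets M"
      unfolding assms by auto
    have "?T l \<subseteq> (\<Union>n. ?A n)"
    proof
      fix z assume "z \<in> ?T l"
      then obtain y s where z: "z = (y, s)" "0 < s" "s < r" "norm (l - y) < \<kappa> * s"
        by (auto simp: truncated_cone_def)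
      have "(\<lambda>m. norm (X m - y)) \<longlonglongrightarrow> norm (l - y)"
        using lim by (intro tendsto_intros)
      then have "\<forall>\<^sub>F m in sequentially. norm (X m - y) < \<kappa> * s"
        using z(4) by (rule order_tendstoD)
      then show "z \<in> (\<Union>n. ?A n)"
        using z by (auto simp: eventually_sequentially truncated_cone_def)
    qed
    then have "emeasure M (?T l) \<le> emeasure M (\<Union>n. ?A n)"
      using A by (intro emeasure_mono) auto
    also have "\<dots> = (SUP n. emeasure M (?A n))"
      using A by (intro SUP_emeasure_incseq[symmetric]) (auto simp: incseq_def)
    also have "\<dots> \<le> c"
    proof (rule SUP_least)
      fix n
      have "emeasure M (?A n) \<le> emeasure M (?T (X n))"
        by (intro emeasure_mono) (auto simp: assms)
      then show "emeasure M (?A n) \<le> c" using X by (auto intro: order_trans)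
    qed
    finally show "emeasure M (?T l) \<le> c" .
  qed
  then show ?thesis
    by (simp add: closed_def Collect_neg_eq[symmetric] not_le)
qed

text \<open>After this lemma \<open>F\<close> enters only through \<open>M\<close>, whose
  monotonicity and subadditivity replace all manipulation of iterated integrals. Since
  \<open>F\<close> is merely Lebesgue measurable, Tonelli is applied to a Borel function
  \<open>g\<close> that agrees almost everywhere with the squared modulus of \<open>F\<close> on the
  half-space.\<close>

lemma cone_integral_eq_emeasure:
  fixes F :: "(real ^ 'd::finite) \<times> real \<Rightarrow> complex"
  assumes "L2_loc upper_half_space F"
  obtains M :: "((real ^ 'd) \<times> real) measure"
  where "sets M = sets borel"
    and "\<And>\<kappa> r x. cone_integral \<kappa> F r x = emeasure M (truncated_cone \<kappa> r x)"
proof -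
  let ?S = "upper_half_space :: ((real ^ 'd) \<times> real) set"
  let ?L = "lborel :: (real ^ 'd) measure" and ?R = "lborel :: real measure"
  have "open ?S"
    unfolding upper_half_space_def case_prod_unfold by (intro open_Collect_less continuous_intros)
  then have S: "?S \<in> sets lebesgue" by simp
  have "F \<in> borel_measurable (lebesgue_on ?S)"
    using assms by (simp add: L2_loc_def)
  then have "(\<lambda>z. ennreal ((cmod (F z))\<^sup>2)) \<in> borel_measurable (lebesgue_on ?S)"
    by measurable
  then have "(\<lambda>z. ennreal ((cmod (F z))\<^sup>2) * indicator ?S z) \<in> borel_measurable lebesgue"
    by (subst (asm) borel_measurable_restrict_space_iff_ennreal) (use S in auto)
  from completion_ex_borel_measurable[OF this] obtain g
    where g [measurable]: "g \<in> borel_measurable lborel"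
      and ae: "AE z in lborel. ennreal ((cmod (F z))\<^sup>2) * indicator ?S z = g z"
    by blast
  \<comment> \<open>The exceptional set is enlarged to a Borel null set: below, "almost every y,
    almost every s" has to become "almost every s, almost every y", the order in
    \<open>cone_integral\<close>, and that exchange requires a measurable set of the
    product.\<close>
  obtain Z where Z: "{z. ennreal ((cmod (F z))\<^sup>2) * indicator ?S z \<noteq> g z} \<subseteq> Z"
    "emeasure lborel Z = 0" and Zs [measurable]: "Z \<in> sets lborel"
    using AE_E[OF ae] by auto
  have "AE z in lborel. z \<notin> Z"
    using Z Zs by (intro AE_not_in) auto
  then have "AE z in ?L \<Otimes>\<^sub>M ?R. z \<notin> Z"
    unfolding lborel_prod .
  then have "AE y in ?L. AE s in ?R. (y, s) \<notin> Z"
    by (rule lborel_pair.AE_pair)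
  moreover have "{z \<in> space (?L \<Otimes>\<^sub>M ?R). (fst z, snd z) \<notin> Z} \<in> sets (?L \<Otimes>\<^sub>M ?R)"
    unfolding lborel_prod using Zs by (simp add: Compl_eq[symmetric])
  ultimately have "AE s in ?R. AE y in ?L. (y, s) \<notin> Z"
    by (subst (asm) lborel_pair.AE_commute) auto
  then have eq: "AE s in ?R. AE y in ?L. s > 0 \<longrightarrow> ennreal ((cmod (F (y, s)))\<^sup>2) = g (y, s)"
  proof (eventually_elim, elim eventually_mono, intro impI)
    fix y s assume "(y, s) \<notin> Z" "0 < s"
    moreover from this have "ennreal ((cmod (F (y, s)))\<^sup>2) * indicator ?S (y, s) = g (y, s)"
      using Z(1) by blast
    ultimately show "ennreal ((cmod (F (y, s)))\<^sup>2) = g (y, s)"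
      by (simp add: upper_half_space_def)
  qed
  \<comment> \<open>The exponent \<open>CARD('d) + 1\<close> is n. Values of \<open>h\<close> at s
    \<le> 0 are immaterial, as the cones lie in s > 0.\<close>
  define h where "h = (\<lambda>(y, s). g (y, s) / ennreal (s ^ (CARD('d) + 1)))"
  have h [measurable]: "h \<in> borel_measurable borel"
  proof -
    have "h = (\<lambda>z. g z / ennreal (snd z ^ (CARD('d) + 1)))"
      by (auto simp: h_def)
    also have "\<dots> \<in> borel_measurable borel"
    proof (intro borel_measurable_divide_ennreal measurable_compose[OF _ measurable_ennreal])
      show "g \<in> borel_measurable borel" using g by simp
      show "(\<lambda>z :: (real ^ 'd) \<times> real. snd z ^ (CARD('d) + 1)) \<in> borel_measurable borel"
        by (intro borel_measurable_continuous_onI continuous_intros)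
    qed
    finally show ?thesis .
  qed
  let ?M = "density lborel h"
  show ?thesis
  proof
    show "sets ?M = sets borel" by simp
    fix \<kappa> r and x :: "real ^ 'd"
    let ?k = "\<lambda>z. h z * indicator (truncated_cone \<kappa> r x) z"
    have k: "?k \<in> borel_measurable (?L \<Otimes>\<^sub>M ?R)"
      unfolding lborel_prod using h by measurable
    have "cone_integral \<kappa> F r x = (\<integral>\<^sup>+s. (\<integral>\<^sup>+y. ?k (y, s) \<partial>?L) \<partial>?R)"
      unfolding cone_integral_def nn_integral_completion
    proof (rule nn_integral_cong_AE, use eq in eventually_elim)
      case (elim s)
      show ?case
      proof (cases "s \<in> {0<..<r}")
        case True
        have "(\<integral>\<^sup>+y\<in>{y. norm (x - y) < \<kappa> * s}. ennreal ((cmod (F (y, s)))\<^sup>2) \<partial>lborel) / ennreal (s ^ (CARD('d) + 1))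
          = (\<integral>\<^sup>+y\<in>{y. norm (x - y) < \<kappa> * s}. g (y, s) \<partial>lborel) / ennreal (s ^ (CARD('d) + 1))"
        proof (rule arg_cong[where f = "\<lambda>u. u / _"], rule nn_integral_cong_AE, use elim in eventually_elim)
          case (elim y)
          then show ?case using True by simp
        qed
        also have "\<dots> = (\<integral>\<^sup>+y. (g (y, s) * indicator {y. norm (x - y) < \<kappa> * s} y) / ennreal (s ^ (CARD('d) + 1)) \<partial>lborel)"
        proof (rule nn_integral_divide[symmetric])
          have "(\<lambda>y. g (y, s)) \<in> borel_measurable borel"
          proof (rule measurable_compose[of "\<lambda>y. (y, s)" borel borel])
            show "(\<lambda>y :: real ^ 'd. (y, s)) \<in> borel_measurable borel"
              by (intro borel_measurable_continuous_onI continuous_intros)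
            show "g \<in> borel_measurable borel" using g by simp
          qed
          moreover have "{y. norm (x - y) < \<kappa> * s} \<in> sets borel"
            by (intro borel_open open_Collect_less continuous_intros)
          ultimately show "(\<lambda>y. g (y, s) * indicator {y. norm (x - y) < \<kappa> * s} y) \<in> borel_measurable lborel"
            by simp
        qed
        also have "\<dots> = (\<integral>\<^sup>+y. ?k (y, s) \<partial>?L)"
          using True by (intro nn_integral_cong) (auto simp: h_def truncated_cone_def indicator_def)
        finally show ?thesis using True by simp
      next
        case False
        then show ?thesis by (auto simp: truncated_cone_def indicator_def)
      qed
    qed
    also have "\<dots> = integral\<^sup>N (?L \<Otimes>\<^sub>M ?R) ?k"
      by (rule lborel_pair.nn_integral_snd[OF k])
    also have "\<dots> = emeasure ?M (truncated_cone \<kappa> r x)"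
      unfolding lborel_prod by (simp add: emeasure_density)
    finally show "cone_integral \<kappa> F r x = emeasure ?M (truncated_cone \<kappa> r x)" .
  qed
qed

section \<open>Measure, diameter and dyadic subdivision of cubes\<close>

lemma cube_set_borel [measurable]: "cube_set Q \<in> sets borel"
proof (cases Q)
  case (Pair a l)
  have "(\<lambda>x :: real ^ 'a. x $ i) \<in> borel_measurable borel" for i
    by (intro borel_measurable_continuous_onI continuous_intros)
  then show ?thesis unfolding Pair by simp
qed

lemma emeasure_cube_set_pos:
  assumes "side Q > 0"
  shows "emeasure lebesgue (cube_set Q) > 0"
proof (cases Q)
  case (Pair a l)
  let ?b = "a + (\<chi> i. l)"
  have "box a ?b \<noteq> {}"
    using assms by (simp add: box_ne_empty Basis_vec_def Pair inner_axis)
  then have "emeasure lborel (box a ?b) \<noteq> 0"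
    using open_not_negligible[OF open_box] by (auto simp: negligible_iff_null_sets null_sets_def)
  moreover have "emeasure lborel (box a ?b) \<le> emeasure lborel (cube_set Q)"
    by (intro emeasure_mono) (auto simp: Pair mem_box_cart less_imp_le)
  ultimately show ?thesis by (auto simp: zero_less_iff_neq_zero)
qed

lemma emeasure_cube_set_finite: "emeasure lebesgue (cube_set Q) < top"
proof (cases Q)
  case (Pair a l)
  let ?b = "a + (\<chi> i. l)"
  have "emeasure lborel (cube_set Q) \<le> emeasure lborel (cbox a ?b)"
    by (intro emeasure_mono) (auto simp: Pair mem_box_cart less_imp_le)
  also have "\<dots> < top"
    using emeasure_lborel_cbox_finite[of a ?b] by simp
  finally show ?thesis by simp
qed

lemma norm_diff_cube_set:
  fixes x y :: "real ^ 'd::finite"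
  assumes "x \<in> cube_set Q" "y \<in> cube_set Q"
  shows "norm (x - y) \<le> sqrt (real CARD('d)) * side Q"
proof (cases Q)
  case (Pair a l)
  have "l \<ge> 0" using assms by (auto simp: Pair dest!: spec)
  have "\<bar>(x - y) $ i\<bar> \<le> \<bar>((\<chi> i. l) :: real ^ 'd) $ i\<bar>" for i
    using assms by (auto simp: Pair dest!: spec[of _ i])
  then have "norm (x - y) \<le> norm ((\<chi> i. l) :: real ^ 'd)"
    by (intro norm_le_componentwise_cart) simp
  also have "\<dots> = sqrt (real CARD('d)) * l"
    using \<open>l \<ge> 0\<close> by (simp add: norm_vec_def L2_set_def real_sqrt_mult)
  finally show ?thesis by (simp add: Pair)
qed

lemma dyadic_children_eq_image:
  "dyadic_children (a, l) = (\<lambda>e. (a + (l / 2) *\<^sub>R e, l / 2)) ` {e. \<forall>i. e $ i = 0 \<or> e $ i = 1}"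
  by auto

lemma finite_dyadic_children: "finite (dyadic_children (Q :: 'd::finite cube))"
proof (cases Q)
  case (Pair a l)
  have "{e :: real ^ 'd. \<forall>i. e $ i = 0 \<or> e $ i = 1} = vec_lambda ` (UNIV \<rightarrow>\<^sub>E {0, 1})"
    by (force simp: PiE_def Pi_def intro!: image_eqI[of _ _ "\<lambda>i. _ $ i"])
  then have "finite {e :: real ^ 'd. \<forall>i. e $ i = 0 \<or> e $ i = 1}"
    by (simp add: finite_PiE)
  then show ?thesis unfolding Pair dyadic_children_eq_image by (rule finite_imageI)
qed

lemma side_dyadic_children: "C \<in> dyadic_children Q \<Longrightarrow> side C = side Q / 2"
  by (cases Q) auto

lemma Union_dyadic_children:
  assumes "side Q > 0"
  shows "(\<Union>C\<in>dyadic_children Q. cube_set C) = cube_set Q"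
proof (cases Q)
  case (Pair a l)
  have l: "l > 0" using assms Pair by simp
  show ?thesis
  proof (intro subset_antisym subsetI)
    fix x assume "x \<in> (\<Union>C\<in>dyadic_children Q. cube_set C)"
    then obtain e where e: "\<And>i. e $ i = 0 \<or> e $ i = 1" "x \<in> cube_set (a + (l / 2) *\<^sub>R e, l / 2)"
      unfolding Pair dyadic_children_eq_image by blast
    have "a $ i \<le> x $ i \<and> x $ i < a $ i + l" for i
      using e(1)[of i] e(2) l by (auto dest!: spec[of _ i])
    then show "x \<in> cube_set Q" by (simp add: Pair)
  next
    fix x assume x: "x \<in> cube_set Q"
    define e :: "real ^ 'a" where "e = (\<chi> i. if x $ i < a $ i + l / 2 then 0 else 1)"
    have "x \<in> cube_set (a + (l / 2) *\<^sub>R e, l / 2)"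
      using x by (auto simp: e_def Pair add.commute)
    moreover have "(a + (l / 2) *\<^sub>R e, l / 2) \<in> dyadic_children Q"
      unfolding Pair dyadic_children_eq_image by (rule imageI) (simp add: e_def)
    ultimately show "x \<in> (\<Union>C\<in>dyadic_children Q. cube_set C)" by blast
  qed
qed

lemma disjoint_dyadic_children: "disjoint_family_on cube_set (dyadic_children Q)"
proof (cases Q)
  case (Pair a l)
  show ?thesis
    unfolding disjoint_family_on_def
  proof (intro ballI impI, rule ccontr)
    fix B C assume BC: "B \<in> dyadic_children Q" "C \<in> dyadic_children Q" "B \<noteq> C"
      "cube_set B \<inter> cube_set C \<noteq> {}"
    then obtain x d e
      where d: "\<And>i. d $ i = 0 \<or> d $ i = 1" "B = (a + (l / 2) *\<^sub>R d, l / 2)" "x \<in> cube_set B"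
        and e: "\<And>i. e $ i = 0 \<or> e $ i = 1" "C = (a + (l / 2) *\<^sub>R e, l / 2)" "x \<in> cube_set C"
      unfolding Pair dyadic_children_eq_image by blast
    have "d $ i = e $ i" for i
      using d(1)[of i] e(1)[of i] d(3) e(3) unfolding d(2) e(2) by (auto dest!: spec[of _ i])
    then have "d = e" by (simp add: vec_eq_iff)
    then show False using BC d e by simp
  qed
qed

lemma emeasure_dyadic_children:
  assumes "side Q > 0" "X \<in> sets lebesgue"
  shows "emeasure lebesgue (X \<inter> cube_set Q)
    = (\<Sum>C\<in>dyadic_children Q. emeasure lebesgue (X \<inter> cube_set C))"
proof -
  have "(\<Sum>C\<in>dyadic_children Q. emeasure lebesgue (X \<inter> cube_set C))
    = emeasure lebesgue (\<Union>C\<in>dyadic_children Q. X \<inter> cube_set C)"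
  proof (intro sum_emeasure finite_dyadic_children)
    show "disjoint_family_on (\<lambda>C. X \<inter> cube_set C) (dyadic_children Q)"
      using disjoint_dyadic_children[of Q] unfolding disjoint_family_on_def by blast
  qed (use assms(2) in auto)
  also have "(\<Union>C\<in>dyadic_children Q. X \<inter> cube_set C) = X \<inter> cube_set Q"
    using Union_dyadic_children[OF assms(1)] by blast
  finally show ?thesis ..
qed

section \<open>Stopping cubes, the good-lambda inequality and its iteration\<close>

lemma side_dyadic_subcubes_pos:
  assumes "R \<in> dyadic_subcubes Q" "side Q > 0"
  shows "side R > 0"
  using assms by (induction rule: dyadic_subcubes.induct) (simp_all add: side_dyadic_children)

text \<open>This replaces the decomposition of \<open>\<Omega> \<inter> R\<close> into maximal dyadic cubes: the cubes \<open>C\<close> in the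
  assumption are the stopping cubes. Points at distance at least \<open>\<delta>\<close> from the complement of \<open>\<Omega>\<close> lie
  in stopping cubes of bounded generation, so that induction on the side length applies to them.\<close>

lemma stopping_cubes:
  fixes R :: "'d::finite cube" and c :: ennreal
  assumes \<Omega>: "open \<Omega>" and E: "E \<in> sets lebesgue" and R: "side R > 0" "\<not> cube_set R \<subseteq> \<Omega>"
    and child: "\<And>P C. P \<in> dyadic_subcubes R \<Longrightarrow> \<not> cube_set P \<subseteq> \<Omega> \<Longrightarrow> C \<in> dyadic_children P \<Longrightarrow>
      cube_set C \<subseteq> \<Omega> \<Longrightarrow> emeasure lebesgue (E \<inter> cube_set C) \<le> c * emeasure lebesgue (cube_set C)"
  shows "emeasure lebesgue (E \<inter> \<Omega> \<inter> cube_set R) \<le> c * emeasure lebesgue (\<Omega> \<inter> cube_set R)"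
proof -
  define W where "W \<delta> = {x. ball x \<delta> \<subseteq> \<Omega>}" for \<delta>
  have \<Omega>s: "\<Omega> \<in> sets lebesgue" using \<Omega> by simp
  have Ws: "W \<delta> \<in> sets lebesgue" for \<delta>
  proof -
    have "W \<delta> = - (\<Union>y\<in>-\<Omega>. ball y \<delta>)"
      by (auto simp: W_def dist_commute subset_iff)
    then have "closed (W \<delta>)" by (simp only:) (intro closed_Compl open_UN ballI open_ball)
    then show ?thesis by simp
  qed
  \<comment> \<open>\<open>k\<close> bounds the number of subdivisions until the diameter is below
    \<delta>. At that point a cube that meets the complement of \<Omega> contains no point of
    \<open>W \<delta>\<close>, which is the base case. The right-hand side has \<Omega> in place of
    \<open>W \<delta>\<close>, so the bound survives the limit \<delta> to 0.\<close>
  have step: "emeasure lebesgue (E \<inter> W \<delta> \<inter> cube_set P) \<le> c * emeasure lebesgue (\<Omega> \<inter> cube_set P)"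
    if "\<delta> > 0" "P \<in> dyadic_subcubes R" "\<not> cube_set P \<subseteq> \<Omega>" "sqrt (real CARD('d)) * side P < 2 ^ k * \<delta>"
    for \<delta> k P
    using that(2-)
  proof (induction k arbitrary: P)
    case 0
    have "x \<notin> W \<delta>" if x: "x \<in> cube_set P" for x
    proof
      assume "x \<in> W \<delta>"
      moreover have "cube_set P \<subseteq> ball x \<delta>"
        using norm_diff_cube_set[OF x] 0(3) by (force simp: dist_norm)
      ultimately show False using 0(2) by (auto simp: W_def)
    qed
    then have "E \<inter> W \<delta> \<inter> cube_set P = {}" by blast
    then show ?case by simp
  next
    case (Suc k)
    have P: "side P > 0" by (rule side_dyadic_subcubes_pos[OF Suc.prems(1) R(1)])
    have "emeasure lebesgue (E \<inter> W \<delta> \<inter> cube_set P)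
      = (\<Sum>C\<in>dyadic_children P. emeasure lebesgue (E \<inter> W \<delta> \<inter> cube_set C))"
      using E Ws by (intro emeasure_dyadic_children[OF P]) auto
    also have "\<dots> \<le> (\<Sum>C\<in>dyadic_children P. c * emeasure lebesgue (\<Omega> \<inter> cube_set C))"
    proof (rule sum_mono)
      fix C assume C: "C \<in> dyadic_children P"
      show "emeasure lebesgue (E \<inter> W \<delta> \<inter> cube_set C) \<le> c * emeasure lebesgue (\<Omega> \<inter> cube_set C)"
      \<comment> \<open>A child inside \<Omega> is a stopping cube and the assumption applies to it;
        any other child again meets the complement of \<Omega> and goes to the induction hypothesis
        with half the side.\<close>
      proof (cases "cube_set C \<subseteq> \<Omega>")
        case True
        have "emeasure lebesgue (E \<inter> W \<delta> \<inter> cube_set C) \<le> emeasure lebesgue (E \<inter> cube_set C)"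
          using E by (intro emeasure_mono) auto
        also have "\<dots> \<le> c * emeasure lebesgue (cube_set C)"
          by (rule child[OF Suc.prems(1,2) C True])
        finally show ?thesis using True by (simp add: Int_absorb1)
      next
        case False
        have "C \<in> dyadic_subcubes R"
          using Suc.prems(1) C by (rule dyadic_subcubes.child)
        then show ?thesis
          using Suc.prems(3) by (intro Suc.IH False) (simp_all add: side_dyadic_children[OF C])
      qed
    qed
    also have "\<dots> = c * emeasure lebesgue (\<Omega> \<inter> cube_set P)"
      unfolding emeasure_dyadic_children[OF P \<Omega>s] sum_distrib_left ..
    finally show ?case .
  qed
  have UW: "(\<Union>n. W (inverse (real (Suc n)))) = \<Omega>"
  proof (intro subset_antisym subsetI)
    fix x assume "x \<in> \<Omega>"
    then obtain e where e: "e > 0" "ball x e \<subseteq> \<Omega>"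
      using \<Omega> by (auto simp: open_contains_ball)
    obtain n where "inverse (real (Suc n)) < e"
      using reals_Archimedean[OF e(1)] by blast
    then have "x \<in> W (inverse (real (Suc n)))"
      using e(2) subset_ball[of "inverse (real (Suc n))" e x] unfolding W_def by auto
    then show "x \<in> (\<Union>n. W (inverse (real (Suc n))))" by blast
  next
    fix x assume "x \<in> (\<Union>n. W (inverse (real (Suc n))))"
    then obtain n where "ball x (inverse (real (Suc n))) \<subseteq> \<Omega>"
      unfolding W_def by blast
    then show "x \<in> \<Omega>" by auto
  qed
  have "incseq (\<lambda>n. W (inverse (real (Suc n))))"
  proof (rule incseq_SucI)
    show "W (inverse (real (Suc n))) \<subseteq> W (inverse (real (Suc (Suc n))))" for n
      using subset_ball[of "inverse (real (Suc (Suc n)))" "inverse (real (Suc n))"]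
      unfolding W_def by (auto simp: field_simps)
  qed
  then have inc: "incseq (\<lambda>n. E \<inter> W (inverse (real (Suc n))) \<inter> cube_set R)"
    unfolding incseq_def by blast
  have "E \<inter> \<Omega> \<inter> cube_set R = (\<Union>n. E \<inter> W (inverse (real (Suc n))) \<inter> cube_set R)"
    using UW by blast
  then have "emeasure lebesgue (E \<inter> \<Omega> \<inter> cube_set R)
    = (SUP n. emeasure lebesgue (E \<inter> W (inverse (real (Suc n))) \<inter> cube_set R))"
    using E Ws inc by (simp only:) (intro SUP_emeasure_incseq[symmetric], auto)
  also have "\<dots> \<le> c * emeasure lebesgue (\<Omega> \<inter> cube_set R)"
  proof (rule SUP_least)
    fix n
    let ?\<delta> = "inverse (real (Suc n))"
    obtain k where "sqrt (real CARD('d)) * side R / ?\<delta> < 2 ^ k"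
      using real_arch_pow[of 2 "sqrt (real CARD('d)) * side R / ?\<delta>"] by auto
    then have "sqrt (real CARD('d)) * side R < 2 ^ k * ?\<delta>"
      by (simp add: field_simps)
    then show "emeasure lebesgue (E \<inter> W ?\<delta> \<inter> cube_set R) \<le> c * emeasure lebesgue (\<Omega> \<inter> cube_set R)"
      by (intro step R dyadic_subcubes.root) auto
  qed
  finally show ?thesis .
qed

text \<open>The aperture comes from here: two points of \<open>P\<close> are at distance at most
  \<open>sqrt d\<close> times the side of \<open>P\<close>, which is twice the side of \<open>C\<close>.\<close>

lemma truncated_cone_subset_child_parent:
  fixes P :: "'d::finite cube"
  assumes "C \<in> dyadic_children P" "x \<in> cube_set P" "z \<in> cube_set P"
  shows "truncated_cone 1 r x
    \<subseteq> truncated_cone 1 (side C) x \<union> truncated_cone (1 + 2 * sqrt (real CARD('d))) r z"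
proof -
  have *: "norm (z - y) < (1 + 2 * sqrt (real CARD('d))) * s"
    if "side C \<le> s" "norm (x - y) < s" for y s
  proof -
    have "norm (z - y) \<le> norm (z - x) + norm (x - y)"
      using norm_triangle_ineq[of "z - x" "x - y"] by simp
    also have "norm (z - x) \<le> sqrt (real CARD('d)) * (2 * side C)"
      using norm_diff_cube_set[OF assms(3,2)] unfolding side_dyadic_children[OF assms(1)] by simp
    also have "\<dots> \<le> sqrt (real CARD('d)) * (2 * s)"
      using that by (intro mult_left_mono) auto
    finally show ?thesis using that by (simp add: algebra_simps)
  qed
  show ?thesis
  proof
    fix w assume w: "w \<in> truncated_cone 1 r x"
    obtain y s where "w = (y, s)" by fastforce
    then show "w \<in> truncated_cone 1 (side C) x \<union> truncated_cone (1 + 2 * sqrt (real CARD('d))) r z"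
      using w *[of s y] by (cases "side C \<le> s") (auto simp: truncated_cone_def)
  qed
qed

text \<open>One iteration step: raising the threshold by \<open>N\<close> gains a factor \<alpha>.
  Thresholds are squared, so that no square root has to be taken of a measure. Closure of
  \<open>D\<close> under children and positive sides hold both for the subcubes of a fixed cube and
  for a dyadic grid of the whole space, so the two cases are treated together.\<close>

lemma good_lambda:
  fixes D :: "'d::finite cube set" and M :: "((real ^ 'd) \<times> real) measure"
    and \<phi> :: "real \<Rightarrow> real" and \<alpha> N t :: real and c :: ennreal
  assumes M: "sets M = sets borel"
    and D: "\<And>Q. Q \<in> D \<Longrightarrow> dyadic_children Q \<subseteq> D" "\<And>Q. Q \<in> D \<Longrightarrow> side Q > 0"
    and \<phi>: "\<And>r. r \<ge> 0 \<Longrightarrow> \<phi> r \<ge> 0" "mono_on {0..} \<phi>"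
    and \<alpha>: "0 \<le> \<alpha>" "\<alpha> < 1" and N: "0 \<le> N" and t: "0 \<le> t"
    and wide: "\<And>Q. Q \<in> D \<Longrightarrow> emeasure lebesgue {x \<in> cube_set Q. ennreal ((N * \<phi> (side Q))\<^sup>2)
        < emeasure M (truncated_cone (1 + 2 * sqrt (real CARD('d))) (side Q) x)}
      \<le> ennreal \<alpha> * emeasure lebesgue (cube_set Q)"
    and narrow: "\<And>Q. Q \<in> D \<Longrightarrow> emeasure lebesgue {x \<in> cube_set Q. ennreal ((t * \<phi> (side Q))\<^sup>2)
        < emeasure M (truncated_cone 1 (side Q) x)} \<le> c * emeasure lebesgue (cube_set Q)"
    and Q: "Q \<in> D"
  shows "emeasure lebesgue {x \<in> cube_set Q. ennreal (((t + N) * \<phi> (side Q))\<^sup>2)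
        < emeasure M (truncated_cone 1 (side Q) x)} \<le> ennreal \<alpha> * c * emeasure lebesgue (cube_set Q)"
proof -
  let ?\<kappa> = "1 + 2 * sqrt (real CARD('d))"
  let ?S = "\<lambda>\<kappa> Q x. emeasure M (truncated_cone \<kappa> (side Q) x)"
  let ?p = "\<phi> (side Q)"
  define \<Omega> where "\<Omega> = {x. ennreal ((N * ?p)\<^sup>2) < ?S ?\<kappa> Q x}"
  define E where "E = {x. ennreal (((t + N) * ?p)\<^sup>2) < ?S 1 Q x}"
  have \<Omega>: "open \<Omega>" and "open E"
    unfolding \<Omega>_def E_def by (rule open_emeasure_truncated_cone_gt[OF M])+
  then have E: "E \<in> sets lebesgue" by simp
  have p: "0 \<le> ?p" using \<phi>(1) D(2)[OF Q] by simp
  have sub: "P \<in> D \<and> side P \<le> side Q" if "P \<in> dyadic_subcubes Q" for P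
    using that
  proof induction
    case root
    then show ?case using Q by simp
  next
    case (child P C)
    then show ?case using D side_dyadic_children[of C P] by fastforce
  qed
  have \<Omega>Q: "emeasure lebesgue (\<Omega> \<inter> cube_set Q) \<le> ennreal \<alpha> * emeasure lebesgue (cube_set Q)"
    using wide[OF Q] unfolding \<Omega>_def by (simp add: Int_def conj_commute)
  \<comment> \<open>Here \<alpha> < 1 is decisive: \<open>Q\<close> has positive finite measure, so
    \<Omega> cannot cover it. Hence the subdivision starts from a cube that is not itself a stopping
    cube, and every stopping cube has a parent in \<open>D\<close>.\<close>
  have Qbad: "\<not> cube_set Q \<subseteq> \<Omega>"
  proof
    assume "cube_set Q \<subseteq> \<Omega>"
    then have "emeasure lebesgue (cube_set Q) \<le> ennreal \<alpha> * emeasure lebesgue (cube_set Q)"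
      using \<Omega>Q by (simp add: Int_absorb1)
    moreover obtain v where "emeasure lebesgue (cube_set Q) = ennreal v" "v > 0"
      using emeasure_cube_set_pos[OF D(2)[OF Q]] emeasure_cube_set_finite[of Q]
      by (cases "emeasure lebesgue (cube_set Q)") (auto simp: ennreal_less_zero_iff)
    ultimately show False using \<alpha> by (simp add: ennreal_mult[symmetric])
  qed
  \<comment> \<open>The cone of aperture 1 lies in the wide one and the threshold of
    \<open>E\<close> is the larger, so nothing is lost by restricting \<open>E\<close> to
    \<Omega>.\<close>
  have "E \<subseteq> \<Omega>"
  proof
    fix x assume "x \<in> E"
    have "ennreal ((N * ?p)\<^sup>2) \<le> ennreal (((t + N) * ?p)\<^sup>2)"
      using p N t by (intro ennreal_leI power_mono mult_right_mono) auto
    also have "\<dots> < ?S 1 Q x" using \<open>x \<in> E\<close> by (simp add: E_def)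
    also have "\<dots> \<le> ?S ?\<kappa> Q x"
      by (intro emeasure_mono truncated_cone_mono) (auto simp: M)
    finally show "x \<in> \<Omega>" by (simp add: \<Omega>_def)
  qed
  have "emeasure lebesgue (E \<inter> \<Omega> \<inter> cube_set Q) \<le> c * emeasure lebesgue (\<Omega> \<inter> cube_set Q)"
  proof (rule stopping_cubes[OF \<Omega> E D(2)[OF Q] Qbad])
    fix P C assume P: "P \<in> dyadic_subcubes Q" "\<not> cube_set P \<subseteq> \<Omega>" and C: "C \<in> dyadic_children P"
    \<comment> \<open>At this point of the parent the wide square function of \<open>Q\<close> is
      still small; it controls the part of the narrow cone at height \<open>side C\<close> and
      above.\<close>
    obtain z where z: "z \<in> cube_set P" "?S ?\<kappa> Q z \<le> ennreal ((N * ?p)\<^sup>2)"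
      using P(2) unfolding \<Omega>_def subset_iff mem_Collect_eq not_less[symmetric] by blast
    have PD: "P \<in> D" and Psub: "side P \<le> side Q" using sub[OF P(1)] by auto
    have CD: "C \<in> D" using D(1)[OF PD] C by blast
    have sides: "0 < side C" "side C \<le> side Q"
      using D(2)[OF PD] Psub side_dyadic_children[OF C] by auto
    then have pC: "0 \<le> \<phi> (side C)" "\<phi> (side C) \<le> ?p"
      using \<phi> by (auto simp: mono_on_def)
    have "E \<inter> cube_set C \<subseteq> {x \<in> cube_set C. ennreal ((t * \<phi> (side C))\<^sup>2) < ?S 1 C x}"
    proof safe
      fix x assume x: "x \<in> E" "x \<in> cube_set C"
      show "ennreal ((t * \<phi> (side C))\<^sup>2) < ?S 1 C x"
      proof (rule ccontr)
        assume "\<not> ennreal ((t * \<phi> (side C))\<^sup>2) < ?S 1 C x"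
        then have "?S 1 C x \<le> ennreal ((t * \<phi> (side C))\<^sup>2)" by simp
        also have "\<dots> \<le> ennreal ((t * ?p)\<^sup>2)"
          using pC t by (intro ennreal_leI power_mono mult_left_mono) auto
        finally have *: "?S 1 C x \<le> ennreal ((t * ?p)\<^sup>2)" .
        have "x \<in> cube_set P"
          using Union_dyadic_children[OF D(2)[OF PD]] C x(2) by blast
        then have "?S 1 Q x \<le> emeasure M (truncated_cone 1 (side C) x \<union> truncated_cone ?\<kappa> (side Q) z)"
          using truncated_cone_subset_child_parent[OF C _ z(1)] by (intro emeasure_mono) (auto simp: M)
        also have "\<dots> \<le> ?S 1 C x + ?S ?\<kappa> Q z"
          by (intro emeasure_subadditive) (auto simp: M)
        also have "\<dots> \<le> ennreal ((t * ?p)\<^sup>2) + ennreal ((N * ?p)\<^sup>2)"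
          by (intro add_mono * z)
        also have "\<dots> = ennreal ((t * ?p)\<^sup>2 + (N * ?p)\<^sup>2)"
          by simp
        \<comment> \<open>Squares of the two bounds add up to at most the square of their sum: the
          cross term is nonnegative.\<close>
        also have "\<dots> \<le> ennreal (((t + N) * ?p)\<^sup>2)"
          using t N p by (intro ennreal_leI) (simp add: power2_eq_square algebra_simps)
        finally show False using x(1) by (simp add: E_def not_less[symmetric])
      qed
    qed
    moreover have "{x \<in> cube_set C. ennreal ((t * \<phi> (side C))\<^sup>2) < ?S 1 C x} \<in> sets lebesgue"
      using borel_open[OF open_emeasure_truncated_cone_gt[OF M]] cube_set_borel[of C]
      by (auto simp: Collect_conj_eq simp del: cube_set.simps intro!: sets.Int sets_completionI_sets)
    ultimately have "emeasure lebesgue (E \<inter> cube_set C)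
      \<le> emeasure lebesgue {x \<in> cube_set C. ennreal ((t * \<phi> (side C))\<^sup>2) < ?S 1 C x}"
      by (intro emeasure_mono)
    also have "\<dots> \<le> c * emeasure lebesgue (cube_set C)" by (rule narrow[OF CD])
    finally show "emeasure lebesgue (E \<inter> cube_set C) \<le> c * emeasure lebesgue (cube_set C)" .
  qed
  also have "\<dots> \<le> c * (ennreal \<alpha> * emeasure lebesgue (cube_set Q))"
    by (intro mult_left_mono \<Omega>Q) simp
  also have "E \<inter> \<Omega> \<inter> cube_set Q = {x \<in> cube_set Q. ennreal (((t + N) * ?p)\<^sup>2) < ?S 1 Q x}"
    using \<open>E \<subseteq> \<Omega>\<close> by (auto simp: E_def)
  finally show ?thesis by (simp add: ac_simps)
qed

text \<open>The starting level \<open>t\<close> is arbitrary, so that a general threshold can later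
  be split into a multiple of \<open>N\<close> and a nonnegative remainder.\<close>

lemma level_set_geometric_decay:
  fixes D :: "'d::finite cube set" and M :: "((real ^ 'd) \<times> real) measure"
    and \<phi> :: "real \<Rightarrow> real" and \<alpha> N t :: real
  assumes M: "sets M = sets borel"
    and D: "\<And>Q. Q \<in> D \<Longrightarrow> dyadic_children Q \<subseteq> D" "\<And>Q. Q \<in> D \<Longrightarrow> side Q > 0"
    and \<phi>: "\<And>r. r \<ge> 0 \<Longrightarrow> \<phi> r \<ge> 0" "mono_on {0..} \<phi>"
    and \<alpha>: "0 \<le> \<alpha>" "\<alpha> < 1" and N: "0 \<le> N" and t: "0 \<le> t"
    and wide: "\<And>Q. Q \<in> D \<Longrightarrow> emeasure lebesgue {x \<in> cube_set Q. ennreal ((N * \<phi> (side Q))\<^sup>2)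
        < emeasure M (truncated_cone (1 + 2 * sqrt (real CARD('d))) (side Q) x)}
      \<le> ennreal \<alpha> * emeasure lebesgue (cube_set Q)"
    and Q: "Q \<in> D"
  shows "emeasure lebesgue {x \<in> cube_set Q. ennreal (((t + real k * N) * \<phi> (side Q))\<^sup>2)
        < emeasure M (truncated_cone 1 (side Q) x)} \<le> ennreal (\<alpha> ^ k) * emeasure lebesgue (cube_set Q)"
  using Q
\<comment> \<open>\<open>Q\<close> is generalised because \<open>good_lambda\<close> uses the
  previous bound on the stopping cubes, not on \<open>Q\<close> alone.\<close>
proof (induction k arbitrary: Q)
  case 0
  have *: "emeasure lebesgue {x \<in> cube_set Q. P x} \<le> emeasure lebesgue (cube_set Q)" for P
    using cube_set_borel[of Q] by (intro emeasure_mono) auto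
  show ?case by (intro order_trans[OF *]) simp
next
  case (Suc k)
  have *: "t + real k * N + N = t + real (Suc k) * N" by (simp add: algebra_simps)
  have "ennreal \<alpha> * ennreal (\<alpha> ^ k) = ennreal (\<alpha> ^ Suc k)"
    using \<alpha> by (simp add: ennreal_mult)
  have "0 \<le> t + real k * N" using t N by simp
  from good_lambda[OF M D \<phi> \<alpha> N this wide Suc.IH Suc.prems]
  show ?case unfolding \<open>ennreal \<alpha> * ennreal (\<alpha> ^ k) = ennreal (\<alpha> ^ Suc k)\<close> * .
qed

section \<open>Integrals of functions with geometrically decaying level sets\<close>

text \<open>A discrete layer-cake estimate: where \<open>f\<close> lies above level \<open>j\<close>
  but not above level \<open>j + 1\<close>, \<open>\<Psi> (f x)\<close> is at most
  \<open>\<Psi>\<close> at level \<open>j + 1\<close>, and such points lie in \<open>L j\<close>.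
  The decay makes the intersection of all \<open>L k\<close> null, so almost every point has a last
  level. The case \<open>w = 0\<close> is included: all \<open>L k\<close> then coincide and the
  decay forces \<open>f\<close> to vanish almost everywhere on \<open>A\<close>.\<close>

lemma nn_integral_le_geometric_levels:
  fixes f :: "'a \<Rightarrow> ennreal" and \<Psi> :: "ennreal \<Rightarrow> ennreal" and \<alpha> w :: real
  assumes A: "emeasure M A < top" and w: "0 \<le> w" and \<alpha>: "0 \<le> \<alpha>" "\<alpha> < 1"
    and \<Psi>: "mono \<Psi>" "\<Psi> 0 = 0"
    and meas: "\<And>k::nat. {x \<in> A. ennreal (real k * w) < f x} \<in> sets M"
    and decay: "\<And>k::nat. emeasure M {x \<in> A. ennreal (real k * w) < f x} \<le> ennreal (\<alpha> ^ k) * emeasure M A"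
  shows "(\<integral>\<^sup>+x\<in>A. \<Psi> (f x) \<partial>M)
    \<le> (\<Sum>k. \<Psi> (ennreal (real (Suc k) * w)) * ennreal (\<alpha> ^ k)) * emeasure M A"
proof -
  define L where "L k = {x \<in> A. ennreal (real k * w) < f x}" for k
  have L [measurable]: "L k \<in> sets M" for k using meas by (simp add: L_def)
  have "emeasure M (\<Inter>k. L k) \<le> 0"
  proof (rule LIMSEQ_le_const)
    obtain v where v: "emeasure M A = ennreal v" "v \<ge> 0"
      using A by (cases "emeasure M A") auto
    have "(\<lambda>k. ennreal (\<alpha> ^ k * v)) \<longlonglongrightarrow> ennreal (0 * v)"
      using \<alpha> by (intro tendsto_ennrealI tendsto_mult LIMSEQ_power_zero tendsto_const) auto
    then show "(\<lambda>k. ennreal (\<alpha> ^ k) * emeasure M A) \<longlonglongrightarrow> 0"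
      using \<alpha> v by (simp add: ennreal_mult)
    have "emeasure M (\<Inter>k. L k) \<le> ennreal (\<alpha> ^ k) * emeasure M A" for k
    proof -
      have "emeasure M (\<Inter>k. L k) \<le> emeasure M (L k)"
        by (rule emeasure_mono[OF _ L]) blast
      also have "\<dots> \<le> ennreal (\<alpha> ^ k) * emeasure M A"
        unfolding L_def by (rule decay)
      finally show ?thesis .
    qed
    then show "\<exists>m. \<forall>k\<ge>m. emeasure M (\<Inter>k. L k) \<le> ennreal (\<alpha> ^ k) * emeasure M A"
      by blast
  qed
  moreover have "(\<Inter>k. L k) \<in> sets M"
    by measurable
  ultimately have "(\<Inter>k. L k) \<in> null_sets M"
    by (simp add: null_sets_def)
  then have "AE x in M. x \<notin> (\<Inter>k. L k)"
    by (rule AE_not_in)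
  then have "AE x in M. \<Psi> (f x) * indicator A x
    \<le> (\<Sum>k. \<Psi> (ennreal (real (Suc k) * w)) * indicator (L k) x)"
  proof eventually_elim
    case (elim x)
    show ?case
    proof (cases "x \<in> A")
      case True
      from elim have "\<exists>k. x \<notin> L k" by blast
      then obtain k where k: "x \<notin> L k" "\<And>j. j < k \<Longrightarrow> x \<in> L j"
        unfolding exists_least_iff[of "\<lambda>k. x \<notin> L k"] by blast
      show ?thesis
      proof (cases k)
        \<comment> \<open>Level 0 has threshold 0, so a point outside \<open>L 0\<close> contributes
          \<open>\<Psi> 0\<close>, which is 0.\<close>
        case 0
        then have "f x = 0" using k(1) True by (simp add: L_def)
        then show ?thesis using \<Psi> by simp
      next
        case (Suc j)
        have "\<Psi> (f x) \<le> \<Psi> (ennreal (real (Suc j) * w))"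
          using k(1) True by (intro monoD[OF \<Psi>(1)]) (simp add: L_def Suc not_less)
        also have "\<dots> = (\<Sum>k\<in>{j}. \<Psi> (ennreal (real (Suc k) * w)) * indicator (L k) x)"
          using k(2)[of j] Suc by simp
        also have "\<dots> \<le> (\<Sum>k. \<Psi> (ennreal (real (Suc k) * w)) * indicator (L k) x)"
          by (intro sum_le_suminf) auto
        finally show ?thesis using True by simp
      qed
    qed simp
  qed
  then have "(\<integral>\<^sup>+x\<in>A. \<Psi> (f x) \<partial>M)
    \<le> (\<integral>\<^sup>+x. (\<Sum>k. \<Psi> (ennreal (real (Suc k) * w)) * indicator (L k) x) \<partial>M)"
    by (rule nn_integral_mono_AE)
  also have "\<dots> = (\<Sum>k. \<integral>\<^sup>+x. \<Psi> (ennreal (real (Suc k) * w)) * indicator (L k) x \<partial>M)"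
    by (intro nn_integral_suminf) measurable
  also have "\<dots> = (\<Sum>k. \<Psi> (ennreal (real (Suc k) * w)) * emeasure M (L k))"
    by (simp only: nn_integral_cmult_indicator[OF L])
  also have "\<dots> \<le> (\<Sum>k. \<Psi> (ennreal (real (Suc k) * w)) * (ennreal (\<alpha> ^ k) * emeasure M A))"
    using decay unfolding L_def by (intro suminf_le mult_left_mono) auto
  also have "\<dots> = (\<Sum>k. \<Psi> (ennreal (real (Suc k) * w)) * ennreal (\<alpha> ^ k)) * emeasure M A"
    by (simp only: mult.assoc[symmetric] ennreal_suminf_multc)
  finally show ?thesis .
qed

section \<open>Order, powers and exponentials of extended nonnegative reals\<close>

text \<open>For \<open>p = 0\<close> both sides say that \<open>u\<close> is positive, because 0 / 0
  = 0 and u / 0 is infinite otherwise. Zeros of \<phi> therefore need no separate treatment.\<close>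

lemma ennreal_less_divide_iff:
  assumes "0 \<le> c" "0 \<le> p"
  shows "ennreal c < u / ennreal p \<longleftrightarrow> ennreal (c * p) < u"
proof (cases "p = 0")
  case True
  then show ?thesis by (auto simp: zero_less_iff_neq_zero)
next
  case False
  then show ?thesis
    using assms by (cases u) (auto simp: divide_ennreal ennreal_less_iff pos_less_divide_eq ennreal_top_divide)
qed

lemma ennreal_less_powr_half_iff:
  assumes "0 \<le> c"
  shows "ennreal c < ennreal_powr u (1 / 2) \<longleftrightarrow> ennreal (c\<^sup>2) < u"
proof (cases u)
  case (real r)
  have "c < sqrt r \<longleftrightarrow> sqrt (c\<^sup>2) < sqrt r" using assms by simp
  also have "\<dots> \<longleftrightarrow> c\<^sup>2 < r" by (rule real_sqrt_less_iff)
  finally show ?thesis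
    using real assms by (simp add: ennreal_powr_def powr_half_sqrt ennreal_less_iff)
qed (simp add: ennreal_powr_def)

lemma ennreal_powr_mono:
  assumes "u \<le> v" "0 \<le> p"
  shows "ennreal_powr u p \<le> ennreal_powr v p"
proof (cases "v = top")
  case False
  then show ?thesis
    using assms enn2real_mono[of u v]
    by (auto simp: ennreal_powr_def top_unique less_top intro!: ennreal_leI powr_mono2)
qed (simp add: ennreal_powr_def)

lemma ennreal_powr_powr: "ennreal_powr (ennreal_powr u p) q = ennreal_powr u (p * q)"
  by (simp add: ennreal_powr_def powr_powr)

lemma ennreal_powr_ennreal: "0 \<le> r \<Longrightarrow> ennreal_powr (ennreal r) p = ennreal (r powr p)"
  by (simp add: ennreal_powr_def)

lemma ennreal_expm1_mono:
  assumes "u \<le> v"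
  shows "ennreal_expm1 u \<le> ennreal_expm1 v"
proof (cases "v = top")
  case False
  then show ?thesis
    using assms enn2real_mono[of u v]
    by (auto simp: ennreal_expm1_def top_unique less_top intro!: ennreal_leI)
qed (simp add: ennreal_expm1_def)

section \<open>The two series behind the constants\<close>

lemma summable_powr_geometric:
  assumes "0 < \<alpha>" "\<alpha> < 1"
  shows "summable (\<lambda>k. real (Suc k) powr q * \<alpha> ^ k)"
proof -
  \<comment> \<open>Rewriting \<open>\<alpha> ^ k\<close> as an exponential with a fixed rate
    \<open>c > 0\<close> brings the terms into a form whose growth can be compared with 1 /
    k^2.\<close>
  define c where "c = ln (1 / \<alpha>)"
  have c: "c > 0" using assms by (simp add: c_def)
  have "\<alpha> ^ k = exp (- c * real k)" for k
    using assms by (simp add: c_def ln_div exp_of_nat2_mult)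
  moreover have "(\<lambda>k. real (Suc k) powr q * exp (- c * real k)) \<in> O(\<lambda>k. 1 / real k ^ 2)"
    using c by real_asymp
  ultimately have "(\<lambda>k. real (Suc k) powr q * \<alpha> ^ k) \<in> O(\<lambda>k. 1 / real k ^ 2)"
    by simp
  then show ?thesis
    by (rule summable_comparison_test_bigo[rotated]) (simp add: inverse_power_summable divide_inverse)
qed

text \<open>As a difference of two geometric series the sum is exp(1/l) / (1 - \<alpha> exp(1/l)) -
  1 / (1 - \<alpha>), provided \<alpha> exp(1/l) < 1. It tends to 0 as \<open>l\<close> grows, so
  some \<open>l\<close> makes it at most 1. This \<open>l\<close> becomes the constant of the
  exponential norm bound.\<close>

lemma small_exponential_geometric_sum:
  fixes \<alpha> :: real
  assumes "0 < \<alpha>" "\<alpha> < 1"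
  obtains l s where "1 \<le> l" "s \<le> 1" "(\<lambda>k. (exp (real (Suc k) / l) - 1) * \<alpha> ^ k) sums s"
proof -
  have e: "((\<lambda>l. exp (1 / l)) \<longlongrightarrow> (1::real)) at_top" by real_asymp
  have "((\<lambda>l. exp (1 / l) * (1 / (1 - \<alpha> * exp (1 / l))) - 1 / (1 - \<alpha>)) \<longlongrightarrow> 1 * (1 / (1 - \<alpha> * 1)) - 1 / (1 - \<alpha>)) at_top"
    using assms by (intro tendsto_intros e) auto
  then have "\<forall>\<^sub>F l in at_top. exp (1 / l) * (1 / (1 - \<alpha> * exp (1 / l))) - 1 / (1 - \<alpha>) < 1"
    by (rule order_tendstoD) simp
  moreover have "((\<lambda>l. \<alpha> * exp (1 / l)) \<longlongrightarrow> \<alpha> * 1) at_top"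
    by (intro tendsto_intros e)
  then have "\<forall>\<^sub>F l in at_top. \<alpha> * exp (1 / l) < 1"
    using assms by (intro order_tendstoD) auto
  moreover have "\<forall>\<^sub>F l in at_top. (1::real) \<le> l" by (rule eventually_ge_at_top)
  ultimately have "\<forall>\<^sub>F l in at_top. exp (1 / l) * (1 / (1 - \<alpha> * exp (1 / l))) - 1 / (1 - \<alpha>) < 1
      \<and> \<alpha> * exp (1 / l) < 1 \<and> 1 \<le> l"
    by eventually_elim simp
  then obtain l where l_bounds: "exp (1 / l) * (1 / (1 - \<alpha> * exp (1 / l))) - 1 / (1 - \<alpha>) < 1"
      "\<alpha> * exp (1 / l) < 1" "1 \<le> l"
    using eventually_happens by fastforce
  have "(\<lambda>k. exp (1 / l) * (\<alpha> * exp (1 / l)) ^ k - \<alpha> ^ k) sums (exp (1 / l) * (1 / (1 - \<alpha> * exp (1 / l))) - 1 / (1 - \<alpha>))"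
    using assms l_bounds by (intro sums_diff sums_mult geometric_sums) auto
  moreover have "exp (1 / l) * (\<alpha> * exp (1 / l)) ^ k - \<alpha> ^ k = (exp (real (Suc k) / l) - 1) * \<alpha> ^ k" for k
  proof -
    have "exp (1 / l) * exp (1 / l) ^ k = exp (real (Suc k) / l)"
      by (simp add: exp_of_nat_mult[symmetric] exp_add[symmetric] add_divide_distrib del: of_nat_Suc)
         (simp add: add_divide_distrib)
    then show ?thesis by (simp add: power_mult_distrib algebra_simps)
  qed
  ultimately show ?thesis using l_bounds that by (metis (no_types, lifting) ext less_imp_le)
qed

section \<open>Averages, power means and the exponential norm\<close>

lemma average_le_geometric_levels:
  fixes f :: "real ^ 'd::finite \<Rightarrow> ennreal" and \<Psi> :: "ennreal \<Rightarrow> ennreal" and \<alpha> w :: real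
  assumes Q: "side Q > 0" and w: "0 \<le> w" and \<alpha>: "0 \<le> \<alpha>" "\<alpha> < 1"
    and meas: "\<And>k::nat. {x \<in> cube_set Q. ennreal (real k * w) < f x} \<in> sets lebesgue"
    and decay: "\<And>k::nat. emeasure lebesgue {x \<in> cube_set Q. ennreal (real k * w) < f x}
      \<le> ennreal (\<alpha> ^ k) * emeasure lebesgue (cube_set Q)"
    and \<Psi>: "mono \<Psi>" "\<Psi> 0 = 0"
  shows "average Q (\<lambda>x. \<Psi> (f x)) \<le> (\<Sum>k. \<Psi> (ennreal (real (Suc k) * w)) * ennreal (\<alpha> ^ k))"
  unfolding average_def
proof (rule divide_le_posI_ennreal[OF emeasure_cube_set_pos[OF Q]])
  show "(\<integral>\<^sup>+x\<in>cube_set Q. \<Psi> (f x) \<partial>lebesgue)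
    \<le> emeasure lebesgue (cube_set Q) * (\<Sum>k. \<Psi> (ennreal (real (Suc k) * w)) * ennreal (\<alpha> ^ k))"
    using nn_integral_le_geometric_levels[OF emeasure_cube_set_finite w \<alpha> \<Psi> meas decay]
    by (simp only: mult.commute)
qed

text \<open>Homogeneity pulls \<open>w\<close> out of the level sum for the q-th power, leaving a
  series in \<alpha> and \<open>q\<close> only.\<close>

lemma average_powr_le:
  fixes f :: "real ^ 'd::finite \<Rightarrow> ennreal" and \<alpha> w q :: real
  assumes Q: "side Q > 0" and w: "0 \<le> w" and \<alpha>: "0 < \<alpha>" "\<alpha> < 1"
    and meas: "\<And>k::nat. {x \<in> cube_set Q. ennreal (real k * w) < f x} \<in> sets lebesgue"
    and decay: "\<And>k::nat. emeasure lebesgue {x \<in> cube_set Q. ennreal (real k * w) < f x}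
      \<le> ennreal (\<alpha> ^ k) * emeasure lebesgue (cube_set Q)"
    and q: "0 < q"
  shows "ennreal_powr (average Q (\<lambda>x. ennreal_powr (f x) q)) (1 / q)
    \<le> ennreal ((\<Sum>k. real (Suc k) powr q * \<alpha> ^ k) powr (1 / q) * w)"
proof -
  let ?S = "\<Sum>k. real (Suc k) powr q * \<alpha> ^ k"
  have S: "summable (\<lambda>k. real (Suc k) powr q * \<alpha> ^ k)"
    using \<alpha> by (rule summable_powr_geometric)
  have S0: "0 \<le> ?S" using \<alpha> by (intro suminf_nonneg S) auto
  have "mono (\<lambda>u. ennreal_powr u q)"
    using q by (intro monoI ennreal_powr_mono) auto
  moreover have "ennreal_powr 0 q = 0" by (simp add: ennreal_powr_def)
  ultimately have "average Q (\<lambda>x. ennreal_powr (f x) q)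
    \<le> (\<Sum>k. ennreal_powr (ennreal (real (Suc k) * w)) q * ennreal (\<alpha> ^ k))"
    by (rule average_le_geometric_levels[OF Q w less_imp_le[OF \<alpha>(1)] \<alpha>(2) meas decay])
  also have "\<dots> = (\<Sum>k. ennreal (w powr q * (real (Suc k) powr q * \<alpha> ^ k)))"
  proof (rule arg_cong[where f = suminf], rule ext)
    fix k
    show "ennreal_powr (ennreal (real (Suc k) * w)) q * ennreal (\<alpha> ^ k)
      = ennreal (w powr q * (real (Suc k) powr q * \<alpha> ^ k))"
      using w \<alpha> by (simp add: ennreal_powr_ennreal powr_mult ennreal_mult[symmetric] ac_simps del: of_nat_Suc)
  qed
  also have "\<dots> = ennreal (\<Sum>k. w powr q * (real (Suc k) powr q * \<alpha> ^ k))"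
    using \<alpha> by (intro suminf_ennreal2 summable_mult S) auto
  also have "\<dots> = ennreal (w powr q * ?S)"
    by (simp only: suminf_mult[OF S])
  finally have "ennreal_powr (average Q (\<lambda>x. ennreal_powr (f x) q)) (1 / q)
    \<le> ennreal_powr (ennreal (w powr q * ?S)) (1 / q)"
    using q by (intro ennreal_powr_mono) auto
  also have "\<dots> = ennreal ((w powr q * ?S) powr (1 / q))"
    using S0 by (intro ennreal_powr_ennreal) simp
  also have "(w powr q * ?S) powr (1 / q) = ?S powr (1 / q) * w"
    using w q S0 by (simp add: powr_mult powr_powr del: of_nat_Suc)
  finally show ?thesis .
qed

text \<open>For any \<open>t\<close> at least \<open>l * w\<close>, level \<open>k\<close>
  contributes no more than the term \<open>exp (real (Suc k) / l) - 1\<close> of the series, so the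
  average is at most \<open>s\<close> and \<open>t\<close> is admissible in the infimum.\<close>

lemma expL_norm_le:
  fixes f :: "real ^ 'd::finite \<Rightarrow> ennreal" and \<alpha> w l s :: real
  assumes Q: "side Q > 0" and w: "0 \<le> w" and \<alpha>: "0 \<le> \<alpha>" "\<alpha> < 1"
    and meas: "\<And>k::nat. {x \<in> cube_set Q. ennreal (real k * w) < f x} \<in> sets lebesgue"
    and decay: "\<And>k::nat. emeasure lebesgue {x \<in> cube_set Q. ennreal (real k * w) < f x}
      \<le> ennreal (\<alpha> ^ k) * emeasure lebesgue (cube_set Q)"
    and l: "0 < l" "(\<lambda>k. (exp (real (Suc k) / l) - 1) * \<alpha> ^ k) sums s" "s \<le> 1"
  shows "expL_norm Q f \<le> ennreal (l * w)"
proof (rule ennreal_le_epsilon)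
  fix e :: real assume e: "0 < e"
  \<comment> \<open>\<open>l * w\<close> itself may be 0, whereas the infimum runs over positive
    numbers; hence the extra \<open>e\<close>.\<close>
  define t where "t = l * w + e"
  have t: "0 < t" "l * w \<le> t" using e l w by (auto simp: t_def add_nonneg_pos)
  have "mono (\<lambda>u. ennreal_expm1 (u / ennreal t))"
    by (intro monoI ennreal_expm1_mono divide_right_mono_ennreal)
  moreover have "ennreal_expm1 (0 / ennreal t) = 0" by (simp add: ennreal_expm1_def)
  ultimately have "average Q (\<lambda>x. ennreal_expm1 (f x / ennreal t))
    \<le> (\<Sum>k. ennreal_expm1 (ennreal (real (Suc k) * w) / ennreal t) * ennreal (\<alpha> ^ k))"
    by (rule average_le_geometric_levels[OF Q w \<alpha> meas decay])
  also have "\<dots> \<le> (\<Sum>k. ennreal ((exp (real (Suc k) / l) - 1) * \<alpha> ^ k))"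
  proof (intro suminf_le summableI)
    fix k
    have "real (Suc k) * (l * w) \<le> real (Suc k) * t"
      by (intro mult_left_mono t) simp
    then have "real (Suc k) * w / t \<le> real (Suc k) / l"
      using t l by (simp add: divide_simps ac_simps del: of_nat_Suc)
    then have "exp (real (Suc k) * w / t) - 1 \<le> exp (real (Suc k) / l) - 1" by simp
    moreover have "ennreal_expm1 (ennreal (real (Suc k) * w) / ennreal t) = ennreal (exp (real (Suc k) * w / t) - 1)"
      using w t by (simp add: divide_ennreal ennreal_expm1_def del: of_nat_Suc)
    ultimately have "ennreal_expm1 (ennreal (real (Suc k) * w) / ennreal t) \<le> ennreal (exp (real (Suc k) / l) - 1)"
      by (simp add: ennreal_leI del: of_nat_Suc)
    then have "ennreal_expm1 (ennreal (real (Suc k) * w) / ennreal t) * ennreal (\<alpha> ^ k)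
      \<le> ennreal (exp (real (Suc k) / l) - 1) * ennreal (\<alpha> ^ k)"
      by (rule mult_right_mono) simp
    also have "\<dots> = ennreal ((exp (real (Suc k) / l) - 1) * \<alpha> ^ k)"
      using \<alpha> l by (intro ennreal_mult[symmetric]) auto
    finally show "ennreal_expm1 (ennreal (real (Suc k) * w) / ennreal t) * ennreal (\<alpha> ^ k)
      \<le> ennreal ((exp (real (Suc k) / l) - 1) * \<alpha> ^ k)" .
  qed
  also have "\<dots> = ennreal s"
    using \<alpha> l by (subst suminf_ennreal2) (auto simp: sums_iff)
  also have "\<dots> \<le> 1" using l by simp
  finally have "expL_norm Q f \<le> ennreal t"
    unfolding expL_norm_def using t by (intro Inf_lower) blast
  also have "ennreal t = ennreal (l * w) + ennreal e"
    using e l w by (simp add: t_def)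
  finally show "expL_norm Q f \<le> ennreal (l * w) + ennreal e" .
qed

section \<open>From integer levels to all thresholds, and the theorem\<close>

text \<open>With \<open>k\<close> the integer part of t / N, k > t / N - 1; the loss of less than
  one step costs the factor 1 / \<alpha>.\<close>

lemma power_floor_le_exp:
  fixes \<alpha> N t :: real
  assumes "0 < \<alpha>" "\<alpha> < 1" "0 < N" "0 \<le> t"
  obtains k :: nat and u where "t = u + real k * N" "0 \<le> u"
    "\<alpha> ^ k \<le> 1 / \<alpha> * exp (- (ln (1 / \<alpha>) / N) * t)"
proof -
  define k where "k = nat \<lfloor>t / N\<rfloor>"
  have k: "real k \<le> t / N" "t / N < real k + 1"
    using assms unfolding k_def by (auto simp: of_nat_nat)
  have "\<alpha> ^ k = exp (real k * ln \<alpha>)"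
    using assms by (simp add: exp_of_nat_mult)
  also have "\<dots> \<le> exp (- ln \<alpha> + t / N * ln \<alpha>)"
  proof -
    have "(t / N - 1) * - ln \<alpha> \<le> real k * - ln \<alpha>"
      using k assms by (intro mult_right_mono) auto
    then show ?thesis by (simp add: algebra_simps)
  qed
  also have "\<dots> = 1 / \<alpha> * exp (- (ln (1 / \<alpha>) / N) * t)"
    using assms by (simp add: exp_add exp_diff ln_div mult.commute)
  finally have "\<alpha> ^ k \<le> 1 / \<alpha> * exp (- (ln (1 / \<alpha>) / N) * t)" .
  then show ?thesis
    using that[of "t - real k * N" k] k assms by (simp add: pos_le_divide_eq)
qed

theorem lemmaA1:
  shows "\<exists>(C :: real \<Rightarrow> real \<Rightarrow> real) (C' :: real \<Rightarrow> real).
    (\<forall>\<alpha> q. 0 < \<alpha> \<and> \<alpha> < 1 \<and> 0 < q \<longrightarrow> 1 \<le> C \<alpha> q) \<and>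
    (\<forall>\<alpha>. 0 < \<alpha> \<and> \<alpha> < 1 \<longrightarrow> 1 \<le> C' \<alpha>) \<and>
    (\<forall>(F :: (real ^ 'd::finite) \<times> real \<Rightarrow> complex) (\<phi> :: real \<Rightarrow> real) (D :: 'd cube set)
        (\<alpha> :: real) (N :: real).
      L2_loc upper_half_space F \<longrightarrow>
      (\<forall>r\<ge>0. 0 \<le> \<phi> r) \<and> mono_on {0..} \<phi> \<longrightarrow>
      (\<exists>Q0. 0 < side Q0 \<and> D = dyadic_subcubes Q0) \<or> dyadic_grid D \<longrightarrow>
      0 < \<alpha> \<and> \<alpha> < 1 \<and> 0 < N \<longrightarrow>
      (\<forall>Q\<in>D. emeasure lebesgue {x \<in> cube_set Q.
           ennreal_powr (cone_integral (1 + 2 * sqrt (real CARD('d))) F (side Q) x) (1/2)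
             / ennreal (\<phi> (side Q)) > ennreal N}
         \<le> ennreal \<alpha> * emeasure lebesgue (cube_set Q)) \<longrightarrow>
      (\<forall>t>0. (SUP Q\<in>D. emeasure lebesgue {x \<in> cube_set Q.
           ennreal_powr (cone_integral 1 F (side Q) x) (1/2)
             / ennreal (\<phi> (side Q)) > ennreal t}
           / emeasure lebesgue (cube_set Q))
         \<le> ennreal (1 / \<alpha> * exp (- (ln (1 / \<alpha>) / N) * t))) \<and>
      (\<forall>q>0. (SUP Q\<in>D.
           ennreal_powr (average Q (\<lambda>x. ennreal_powr (cone_integral 1 F (side Q) x) (q/2))) (1/q)
             / ennreal (\<phi> (side Q)))
         \<le> ennreal (C \<alpha> q * N)) \<and>
      (SUP Q\<in>D.
           expL_norm Q (\<lambda>x. ennreal_powr (cone_integral 1 F (side Q) x) (1/2))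
             / ennreal (\<phi> (side Q)))
         \<le> ennreal (C' \<alpha> * N))"
proof -
  \<comment> \<open>Choosing \<open>C'\<close> as a function of \<alpha> here, before the data are
    fixed, makes the constant independent of them.\<close>
  have "\<forall>\<alpha>\<in>{0<..<1}. \<exists>l s. 1 \<le> l \<and> s \<le> 1 \<and> (\<lambda>k. (exp (real (Suc k) / l) - 1) * \<alpha> ^ k) sums s"
    by (metis greaterThanLessThan_iff small_exponential_geometric_sum)
  then obtain C' s where *: "\<forall>\<alpha>\<in>{0<..<1}. 1 \<le> C' \<alpha> \<and> s \<alpha> \<le> 1 \<and>
      (\<lambda>k. (exp (real (Suc k) / C' \<alpha>) - 1) * \<alpha> ^ k) sums s \<alpha>"
    unfolding bchoice_iff by blast
  then have C': "1 \<le> C' \<alpha>" "s \<alpha> \<le> 1" "(\<lambda>k. (exp (real (Suc k) / C' \<alpha>) - 1) * \<alpha> ^ k) sums s \<alpha>"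
    if "0 < \<alpha>" "\<alpha> < 1" for \<alpha>
    using that by simp_all
  define C where "C \<alpha> q = max 1 ((\<Sum>k. real (Suc k) powr q * \<alpha> ^ k) powr (1 / q))" for \<alpha> q :: real
  show ?thesis
  proof (intro exI[of _ C] exI[of _ C'] conjI allI impI; (elim conjE)?)
    show "1 \<le> C \<alpha> q" for \<alpha> q by (simp add: C_def)
    show "1 \<le> C' \<alpha>" if "0 < \<alpha>" "\<alpha> < 1" for \<alpha> using that by (rule C'(1))
  next
    fix F :: "(real ^ 'd) \<times> real \<Rightarrow> complex" and \<phi> :: "real \<Rightarrow> real" and D :: "'d cube set" and \<alpha> N :: real
    assume F: "L2_loc upper_half_space F"
      and \<phi>: "\<forall>r\<ge>0. 0 \<le> \<phi> r" "mono_on {0..} \<phi>"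
      and D: "(\<exists>Q0. 0 < side Q0 \<and> D = dyadic_subcubes Q0) \<or> dyadic_grid D"
      and \<alpha>: "0 < \<alpha>" "\<alpha> < 1" and N: "0 < N"
      and wide: "\<forall>Q\<in>D. emeasure lebesgue {x \<in> cube_set Q.
           ennreal_powr (cone_integral (1 + 2 * sqrt (real CARD('d))) F (side Q) x) (1/2)
             / ennreal (\<phi> (side Q)) > ennreal N}
         \<le> ennreal \<alpha> * emeasure lebesgue (cube_set Q)"
    obtain M :: "((real ^ 'd) \<times> real) measure" where M: "sets M = sets borel"
      and FM: "\<And>\<kappa> r x. cone_integral \<kappa> F r x = emeasure M (truncated_cone \<kappa> r x)"
      using cone_integral_eq_emeasure[OF F] by blast
    have side: "0 < side Q" if "Q \<in> D" for Q
      using D that side_dyadic_subcubes_pos by (fastforce simp: dyadic_grid_def)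
    have children: "dyadic_children Q \<subseteq> D" if "Q \<in> D" for Q
      using D that by (auto simp: dyadic_grid_def intro: dyadic_subcubes.child)
    have \<phi>D: "0 \<le> \<phi> (side Q)" if "Q \<in> D" for Q
      using \<phi> side[OF that] by simp
    let ?f = "\<lambda>Q x. ennreal_powr (cone_integral 1 F (side Q) x) (1 / 2)"
    \<comment> \<open>Turns the level sets of the theorem into those of \<open>good_lambda\<close>:
      the division by \<open>p\<close> and the square root move into the threshold.\<close>
    have level: "ennreal c < ennreal_powr (cone_integral \<kappa> F r x) (1 / 2) / ennreal p
      \<longleftrightarrow> ennreal ((c * p)\<^sup>2) < emeasure M (truncated_cone \<kappa> r x)" if "0 \<le> c" "0 \<le> p" for c p \<kappa> r x
      using that by (simp add: ennreal_less_divide_iff ennreal_less_powr_half_iff FM)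
    have level_meas: "{x \<in> cube_set Q. ennreal c < ?f Q x} \<in> sets lebesgue" if "0 \<le> c" for Q c
    proof -
      have "{x. ennreal (c\<^sup>2) < emeasure M (truncated_cone 1 (side Q) x)} \<inter> cube_set Q \<in> sets borel"
        by (intro sets.Int borel_open open_emeasure_truncated_cone_gt[OF M] cube_set_borel)
      then show ?thesis
        using that by (simp add: ennreal_less_powr_half_iff FM Int_def conj_commute)
    qed
    have wide': "emeasure lebesgue {x \<in> cube_set Q. ennreal ((N * \<phi> (side Q))\<^sup>2)
        < emeasure M (truncated_cone (1 + 2 * sqrt (real CARD('d))) (side Q) x)}
      \<le> ennreal \<alpha> * emeasure lebesgue (cube_set Q)" if "Q \<in> D" for Q
      using wide[rule_format, OF that] level[OF less_imp_le[OF N] \<phi>D[OF that]] by simp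
    have decay: "emeasure lebesgue {x \<in> cube_set Q. ennreal (((u + real k * N) * \<phi> (side Q))\<^sup>2)
        < emeasure M (truncated_cone 1 (side Q) x)} \<le> ennreal (\<alpha> ^ k) * emeasure lebesgue (cube_set Q)"
      if "Q \<in> D" "0 \<le> u" for Q u k
      by (rule level_set_geometric_decay[where D = D, OF M children side \<phi>(1)[rule_format] \<phi>(2)
            less_imp_le[OF \<alpha>(1)] \<alpha>(2) less_imp_le[OF N] that(2) wide' that(1)])
    \<comment> \<open>For the two norm bounds the square function stays undivided and the levels
      have spacing \<open>N * \<phi> (side Q)\<close>; the division by \<phi> comes last, in
      \<open>divide_le\<close>.\<close>
    have decay_f: "emeasure lebesgue {x \<in> cube_set Q. ennreal (real k * (N * \<phi> (side Q))) < ?f Q x}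
        \<le> ennreal (\<alpha> ^ k) * emeasure lebesgue (cube_set Q)" if "Q \<in> D" for Q k
      using decay[OF that order_refl, of k] N \<phi>D[OF that]
      by (simp add: ennreal_less_powr_half_iff FM mult.assoc)
    have w: "0 \<le> N * \<phi> (side Q)" if "Q \<in> D" for Q using N \<phi>D[OF that] by simp
    have meas_f: "{x \<in> cube_set Q. ennreal (real k * (N * \<phi> (side Q))) < ?f Q x} \<in> sets lebesgue"
      if "Q \<in> D" for Q and k :: nat
      using w[OF that] by (intro level_meas) simp
    \<comment> \<open>If \<phi> vanishes at the side of \<open>Q\<close>, the assumption forces u =
      0 and the quotient is 0 / 0 = 0.\<close>
    have divide_le: "u / ennreal (\<phi> (side Q)) \<le> ennreal (K * N)"
      if "Q \<in> D" "0 \<le> K" "u \<le> ennreal (K * (N * \<phi> (side Q)))" for Q K u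
    proof -
      have "0 \<le> K * N" using that(2) N by simp
      from ennreal_less_divide_iff[OF this \<phi>D[OF that(1)], of u] show ?thesis
        using that(3) by (metis not_less mult.assoc)
    qed

    show "(SUP Q\<in>D. emeasure lebesgue {x \<in> cube_set Q. ?f Q x / ennreal (\<phi> (side Q)) > ennreal t}
           / emeasure lebesgue (cube_set Q))
         \<le> ennreal (1 / \<alpha> * exp (- (ln (1 / \<alpha>) / N) * t))" if t: "0 < t" for t
    proof (rule SUP_least)
      fix Q assume Q: "Q \<in> D"
      obtain k :: nat and u where u: "t = u + real k * N" "0 \<le> u"
        and le: "\<alpha> ^ k \<le> 1 / \<alpha> * exp (- (ln (1 / \<alpha>) / N) * t)"
        using power_floor_le_exp[OF \<alpha> N less_imp_le[OF t]] by blast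
      have "emeasure lebesgue {x \<in> cube_set Q. ?f Q x / ennreal (\<phi> (side Q)) > ennreal t}
        \<le> ennreal (\<alpha> ^ k) * emeasure lebesgue (cube_set Q)"
        using decay[OF Q u(2), of k] level[OF less_imp_le[OF t] \<phi>D[OF Q]] by (simp add: u(1))
      then have "emeasure lebesgue {x \<in> cube_set Q. ?f Q x / ennreal (\<phi> (side Q)) > ennreal t}
          / emeasure lebesgue (cube_set Q) \<le> ennreal (\<alpha> ^ k)"
        by (intro divide_le_posI_ennreal emeasure_cube_set_pos side Q) (simp only: mult.commute)
      also have "\<dots> \<le> ennreal (1 / \<alpha> * exp (- (ln (1 / \<alpha>) / N) * t))"
        using le by (rule ennreal_leI)
      finally show "emeasure lebesgue {x \<in> cube_set Q. ?f Q x / ennreal (\<phi> (side Q)) > ennreal t}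
          / emeasure lebesgue (cube_set Q) \<le> ennreal (1 / \<alpha> * exp (- (ln (1 / \<alpha>) / N) * t))" .
    qed

    show "(SUP Q\<in>D. ennreal_powr (average Q (\<lambda>x. ennreal_powr (cone_integral 1 F (side Q) x) (q/2))) (1/q)
             / ennreal (\<phi> (side Q))) \<le> ennreal (C \<alpha> q * N)" if q: "0 < q" for q
    proof (intro SUP_least divide_le)
      fix Q assume Q: "Q \<in> D"
      show "Q \<in> D" by (rule Q)
      show "0 \<le> C \<alpha> q" by (simp add: C_def)
      have "ennreal_powr (average Q (\<lambda>x. ennreal_powr (cone_integral 1 F (side Q) x) (q/2))) (1/q)
        = ennreal_powr (average Q (\<lambda>x. ennreal_powr (?f Q x) q)) (1/q)"
        by (simp add: ennreal_powr_powr)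
      also have "\<dots> \<le> ennreal ((\<Sum>k. real (Suc k) powr q * \<alpha> ^ k) powr (1 / q) * (N * \<phi> (side Q)))"
        by (rule average_powr_le[OF side[OF Q] w[OF Q] \<alpha> meas_f[OF Q] decay_f[OF Q] q])
      also have "\<dots> \<le> ennreal (C \<alpha> q * (N * \<phi> (side Q)))"
        using w[OF Q] by (intro ennreal_leI mult_right_mono) (auto simp: C_def)
      finally show "ennreal_powr (average Q (\<lambda>x. ennreal_powr (cone_integral 1 F (side Q) x) (q/2))) (1/q)
        \<le> ennreal (C \<alpha> q * (N * \<phi> (side Q)))" .
    qed

    show "(SUP Q\<in>D. expL_norm Q (?f Q) / ennreal (\<phi> (side Q))) \<le> ennreal (C' \<alpha> * N)"
    proof (intro SUP_least divide_le)
      fix Q assume Q: "Q \<in> D"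
      show "Q \<in> D" by (rule Q)
      have pos: "0 < C' \<alpha>" using C'(1)[OF \<alpha>] by simp
      then show "0 \<le> C' \<alpha>" by simp
      show "expL_norm Q (?f Q) \<le> ennreal (C' \<alpha> * (N * \<phi> (side Q)))"
        by (rule expL_norm_le[OF side[OF Q] w[OF Q] less_imp_le[OF \<alpha>(1)] \<alpha>(2) meas_f[OF Q]
            decay_f[OF Q] pos C'(3)[OF \<alpha>] C'(2)[OF \<alpha>]])
    qed
  qed
qed

end
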